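(* For every $n\ge 1$ there is $\varepsilon_0=\varepsilon_0(n)>0$ such that if a polytope $P\subset\mathbb{R}^n$ has depth complexity $d<\lceil\log_2(n+1)\rceil$, then $$\mathbb{E}\,|h_P(X)-h_{\Delta}(X)|\ge\varepsilon_0,$$ where $\Delta=\Delta^n$ is the standard regular $n$-simplex and $X$ is uniformly distributed (Haar probability measure) on the unit sphere $\mathbb{S}^{n-1}\subset\mathbb{R}^n$.
   Context: $\Delta=\Delta^n\subset\mathbb{R}^n$ is the regular simplex obtained by orthogonally projecting $\mathsf{conv}\{e_1,\dots,e_{n+1}\}\subset\mathbb{R}^{n+1}$ to the hyperplane orthogonal to $(1,\dots,1)$ (identified isometrically with $\mathbb{R}^n$). For a compact convex $P$, $h_P(x)=\max\{\langle x,y\rangle:y\in P\}$ is its support function. Define $\mathcal{P}_{n,0}=\{\{x\}:x\in\mathbb{R}^n\}$ and, for $d>0$, $$\mathcal{P}_{n,d}=\Big\{\sum_{j=1}^m\mathsf{conv}(K_j\cup L_j):m\in\mathbb{N},\ K_j,L_j\in\mathcal{P}_{n,d-1}\Big\}$$ (Minkowski sum, $m\ge1$). The depth complexity of a polytope $P\subset\mathbb{R}^n$ is the smallest $d$ with $P\in\mathcal{P}_{n,d}$. *)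

theory Defs
  imports "HOL-Analysis.Analysis" "HOL-Library.Set_Algebras" "HOL-Probability.Probability_Measure"
begin

section \<open>Support functions\<close>

definition support_fun :: "'a::euclidean_space set \<Rightarrow> 'a \<Rightarrow> real" where
  "support_fun P x = (SUP y\<in>P. x \<bullet> y)"

text \<open>For nonempty compact sets the supremum is a maximum.\<close>

lemma support_fun_attained:
  assumes "compact P" "P \<noteq> {}"
  shows "\<exists>y\<in>P. support_fun P x = x \<bullet> y \<and> (\<forall>z\<in>P. x \<bullet> z \<le> x \<bullet> y)"
proof -
  have "continuous_on P (\<lambda>y. x \<bullet> y)"
    by (intro continuous_intros)
  then obtain y where y: "y \<in> P" "\<And>z. z \<in> P \<Longrightarrow> x \<bullet> z \<le> x \<bullet> y"
    using continuous_attains_sup[OF assms] by blast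
  have "support_fun P x = x \<bullet> y"
    unfolding support_fun_def using y by (intro cSup_eq_maximum) auto
  then show ?thesis
    using y by blast
qed

section \<open>Depth complexity\<close>

text \<open>The sum below is the Minkowski sum of sets from \<open>HOL-Library.Set_Algebras\<close>.\<close>

primrec depth_class :: "nat \<Rightarrow> 'a::euclidean_space set set" where
  "depth_class 0 = range (\<lambda>x. {x})"
| "depth_class (Suc d) =
     {\<Sum>j\<in>{1..m}. convex hull (K j \<union> L j) | (m::nat) K L.
        1 \<le> m \<and> (\<forall>j\<in>{1..m}. K j \<in> depth_class d \<and> L j \<in> depth_class d)}"

definition depth_complexity :: "'a::euclidean_space set \<Rightarrow> nat" where
  "depth_complexity P = (LEAST d. P \<in> depth_class d)"

lemma depth_class_convex:
  assumes "P \<in> depth_class d" shows "convex P"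
proof (cases d)
  case 0
  then show ?thesis using assms by auto
next
  case (Suc e)
  have "convex (\<Sum>j\<in>A. convex hull (K j \<union> L j))" for A :: "nat set" and K L :: "nat \<Rightarrow> 'a set"
    by (rule convex_set_sum) simp
  then show ?thesis using assms Suc by auto
qed

lemma depth_class_conv_Un:
  assumes "K \<in> depth_class d" "L \<in> depth_class d"
  shows "convex hull (K \<union> L) \<in> depth_class (Suc d)"
proof -
  have "convex hull (K \<union> L) = (\<Sum>j\<in>{1..1::nat}. convex hull ((\<lambda>_. K) j \<union> (\<lambda>_. L) j))"
    by simp
  then show ?thesis
    using assms by (simp only: depth_class.simps mem_Collect_eq) force
qed

lemma depth_class_mono:
  assumes "d \<le> e" "P \<in> depth_class d" shows "P \<in> depth_class e"
  using assms
proof (induction e rule: dec_induct)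
  case (step e)
  then have "convex hull (P \<union> P) \<in> depth_class (Suc e)"
    by (intro depth_class_conv_Un) auto
  moreover have "convex hull (P \<union> P) = P"
    using depth_class_convex[OF step.prems] by (simp add: hull_same)
  ultimately show ?case by simp
qed

text \<open>The depth complexity of a nonempty polytope is therefore well defined.\<close>

lemma polytope_in_depth_class:
  assumes "polytope P" "P \<noteq> {}"
  shows "\<exists>d. P \<in> depth_class d"
proof -
  obtain V where V: "finite V" "P = convex hull V"
    using assms(1) unfolding polytope_def by blast
  then have "V \<noteq> {}" using assms(2) by auto
  with V(1) have "\<exists>d. convex hull V \<in> depth_class d"
  proof (induction V rule: finite_ne_induct)
    case (singleton x)
    show ?case by (rule exI[of _ 0]) simp
  next
    case (insert x F)
    then obtain d where d: "convex hull F \<in> depth_class d" by blast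
    have "{x} \<in> depth_class d"
      by (rule depth_class_mono[of 0]) auto
    from depth_class_conv_Un[OF this d]
    have "convex hull ({x} \<union> convex hull F) \<in> depth_class (Suc d)" .
    moreover have "convex hull ({x} \<union> convex hull F) = convex hull (insert x F)"
      by (metis hull_Un_right insert_is_Un)
    ultimately show ?case by metis
  qed
  with V(2) show ?thesis by simp
qed

section \<open>The regular simplex\<close>

text \<open>
  The space \<open>real ^ 'n option\<close> has dimension \<open>CARD('n) + 1\<close>. In it, \<open>1\<close> is the vector all of
  whose coordinates are one, and the unit vectors are the vectors \<open>axis i 1\<close>.
\<close>

definition sum_zero_hyperplane :: "(real ^ 'm) set" where
  "sum_zero_hyperplane = {x. 1 \<bullet> x = 0}"

text \<open>For a linear subspace, \<open>closest_point\<close> is the orthogonal projection.\<close>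

definition projected_simplex :: "(real ^ 'm) set" where
  "projected_simplex = closest_point sum_zero_hyperplane ` (convex hull (range (\<lambda>i. axis i 1)))"

lemma one_inner_one_vec: "(1 :: real ^ 'm) \<bullet> 1 = real CARD('m)"
  by (simp add: inner_vec_def)

lemma closest_point_sum_zero_hyperplane:
  fixes x :: "real ^ 'm"
  shows "closest_point sum_zero_hyperplane x = x - ((1 \<bullet> x) / real CARD('m)) *\<^sub>R 1"
proof (rule sym, rule closest_point_unique)
  let ?y = "x - ((1 \<bullet> x) / real CARD('m)) *\<^sub>R 1"
  show "convex (sum_zero_hyperplane :: (real ^ 'm) set)" 
    unfolding sum_zero_hyperplane_def by (rule convex_hyperplane)
  show "closed (sum_zero_hyperplane :: (real ^ 'm) set)"
    unfolding sum_zero_hyperplane_def by (rule closed_hyperplane)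
  show y: "?y \<in> sum_zero_hyperplane"
    unfolding sum_zero_hyperplane_def by (simp add: inner_diff_right one_inner_one_vec)
  show "\<forall>z\<in>sum_zero_hyperplane. dist x ?y \<le> dist x z"
  proof
    fix z :: "real ^ 'm" assume z: "z \<in> sum_zero_hyperplane"
    have "orthogonal (x - ?y) (?y - z)"
      using y z unfolding sum_zero_hyperplane_def orthogonal_def
      by (simp add: inner_diff_right one_inner_one_vec)
    then have "(norm ((x - ?y) + (?y - z)))\<^sup>2 = (norm (x - ?y))\<^sup>2 + (norm (?y - z))\<^sup>2"
      by (rule norm_add_Pythagorean)
    then have "(norm (x - ?y))\<^sup>2 \<le> (norm (x - z))\<^sup>2"
      by (simp only: diff_add_cancel add_diff_eq) simp
    then show "dist x ?y \<le> dist x z"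
      by (simp add: dist_norm)
  qed
qed

text \<open>Linear isometric identifications of \<open>real ^ 'n\<close> with the hyperplane in \<open>real ^ 'n option\<close>.\<close>

definition hyperplane_identification :: "(real ^ 'n \<Rightarrow> real ^ 'n option) \<Rightarrow> bool" where
  "hyperplane_identification T \<longleftrightarrow>
     linear T \<and> (\<forall>x. norm (T x) = norm x) \<and> range T = sum_zero_hyperplane"

definition regular_simplex :: "(real ^ 'n \<Rightarrow> real ^ 'n option) \<Rightarrow> (real ^ 'n) set" where
  "regular_simplex T = T -` projected_simplex"

lemma hyperplane_identification_exists:
  "\<exists>T :: real ^ 'n \<Rightarrow> real ^ 'n option. hyperplane_identification T"
proof -
  let ?H = "sum_zero_hyperplane :: (real ^ 'n option) set"
  have sub: "subspace ?H"
    unfolding sum_zero_hyperplane_def by (rule subspace_hyperplane)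
  have "(1 :: real ^ 'n option) \<noteq> 0"
    by (simp add: vec_eq_iff)
  then have "dim (UNIV :: (real ^ 'n) set) = dim ?H"
    unfolding sum_zero_hyperplane_def by (simp add: dim_hyperplane)
  from isometries_subspaces[OF subspace_UNIV sub this]
  obtain f :: "real ^ 'n \<Rightarrow> real ^ 'n option"
    where "linear f" "range f = ?H" "\<And>x. norm (f x) = norm x"
    by (metis UNIV_I)
  then show ?thesis
    unfolding hyperplane_identification_def by blast
qed

section \<open>The uniform distribution on the unit sphere\<close>

text \<open>
  Haar probability measure, i.e. the rotation-invariant probability measure, on the unit sphere,
  as a Borel measure on the ambient space that is concentrated on the sphere.
\<close>

definition sphere_haar_measure :: "(real ^ 'n) measure \<Rightarrow> bool" where
  "sphere_haar_measure \<mu> \<longleftrightarrow>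
     prob_space \<mu> \<and> sets \<mu> = sets borel \<and> emeasure \<mu> (sphere 0 1) = 1 \<and>
     (\<forall>f. orthogonal_transformation f \<longrightarrow> distr \<mu> borel f = \<mu>)"

lemma distr_lborel_orthogonal_transformation:
  fixes f :: "'a::euclidean_space \<Rightarrow> 'a"
  assumes f: "orthogonal_transformation f"
  shows "distr lborel borel f = lborel"
proof -
  let ?B = "\<lambda>r. ball (0 :: 'a) r"
  have lin: "linear f" and nf: "\<And>x. norm (f x) = norm x"
    using f by (auto simp: orthogonal_transformation)
  have fm[measurable]: "f \<in> borel_measurable borel"
    using lin by (intro borel_measurable_continuous_onI linear_continuous_on)
      (simp add: linear_conv_bounded_linear)
  define \<nu> where "\<nu> = distr lborel borel f"
  have s\<nu>[simp, measurable_cong]: "sets \<nu> = sets borel" and sp\<nu>[simp]: "space \<nu> = UNIV"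
    by (simp_all add: \<nu>_def)
  have ball: "emeasure \<nu> (?B r) = emeasure lborel (?B r)" for r
  proof -
    have "f -` ?B r = ?B r" by (auto simp: nf)
    then show ?thesis by (simp add: \<nu>_def emeasure_distr)
  qed
  interpret \<nu>: sigma_finite_measure \<nu>
  proof
    have "(\<Union>n::nat. ?B (real n)) = UNIV"
      by (auto intro: reals_Archimedean2)
    then show "\<exists>A. countable A \<and> A \<subseteq> sets \<nu> \<and> \<Union> A = space \<nu> \<and> (\<forall>a\<in>A. emeasure \<nu> a \<noteq> \<infinity>)"
      using emeasure_lborel_ball_finite
      by (intro exI[of _ "range (\<lambda>n::nat. ?B (real n))"]) (auto simp: ball less_top[symmetric])
  qed
  interpret pair_sigma_finite \<nu> "lborel :: 'a measure" ..
  have surj: "surj f"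
    using f by (rule orthogonal_transformation_surj)
  have trans: "(\<integral>\<^sup>+x. h (x + c) \<partial>\<nu>) = (\<integral>\<^sup>+x. h x \<partial>\<nu>)"
    if [measurable]: "h \<in> borel_measurable borel" for h and c :: 'a
  proof -
    obtain b where b: "c = f b" using surj by blast
    have "(\<integral>\<^sup>+x. h (x + c) \<partial>\<nu>) = (\<integral>\<^sup>+x. h (f (b + x)) \<partial>lborel)"
      unfolding \<nu>_def b by (subst nn_integral_distr) (auto simp: linear_add[OF lin] add.commute)
    also have "\<dots> = (\<integral>\<^sup>+x. h (f x) \<partial>distr lborel borel ((+) b))"
      by (subst nn_integral_distr) auto
    also have "\<dots> = (\<integral>\<^sup>+x. h x \<partial>\<nu>)"
      unfolding \<nu>_def lborel_distr_plus by (subst nn_integral_distr) auto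
    finally show ?thesis .
  qed
  have lneg: "(\<integral>\<^sup>+y. h (x - y) \<partial>lborel) = (\<integral>\<^sup>+y. h y \<partial>lborel)"
    if [measurable]: "h \<in> borel_measurable borel" for h and x :: 'a
  proof -
    have "lborel = distr lborel borel (\<lambda>y::'a. x + (-1) *\<^sub>R y)"
      using lborel_affine[of "-1" x] by (simp add: density_1)
    then have "(\<integral>\<^sup>+y. h y \<partial>lborel) = (\<integral>\<^sup>+y. h y \<partial>distr lborel borel (\<lambda>y. x + (-1) *\<^sub>R y))"
      by simp
    also have "\<dots> = (\<integral>\<^sup>+y. h (x - y) \<partial>lborel)"
      by (subst nn_integral_distr) auto
    finally show ?thesis by simp
  qed
  have ltr: "(\<integral>\<^sup>+y. h (x + y) \<partial>lborel) = (\<integral>\<^sup>+y. h y \<partial>lborel)"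
    if [measurable]: "h \<in> borel_measurable borel" for h and x :: 'a
  proof -
    have "(\<integral>\<^sup>+y. h (x + y) \<partial>lborel) = (\<integral>\<^sup>+y. h y \<partial>distr lborel borel ((+) x))"
      by (subst nn_integral_distr) auto
    then show ?thesis by (simp add: lborel_distr_plus)
  qed
  have "\<nu> = lborel"
  proof (rule measure_eqI)
    fix A assume "A \<in> sets \<nu>"
    then have [measurable]: "A \<in> sets borel" by simp
    define D where "D = ?B 1"
    have [measurable]: "D \<in> sets borel" by (simp add: D_def)
    let ?a = "indicator A :: 'a \<Rightarrow> ennreal" and ?b = "indicator D :: 'a \<Rightarrow> ennreal"
    have "emeasure \<nu> A * emeasure lborel D = (\<integral>\<^sup>+x. (\<integral>\<^sup>+y. ?a x * ?b (x + y) \<partial>lborel) \<partial>\<nu>)"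
    proof -
      have "(\<integral>\<^sup>+y. ?a x * ?b (x + y) \<partial>lborel) = ?a x * emeasure lborel D" for x
      proof -
        have "(\<integral>\<^sup>+y. ?a x * ?b (x + y) \<partial>lborel) = ?a x * (\<integral>\<^sup>+y. ?b (x + y) \<partial>lborel)"
          by (rule nn_integral_cmult) measurable
        also have "(\<integral>\<^sup>+y. ?b (x + y) \<partial>lborel) = (\<integral>\<^sup>+y. ?b y \<partial>lborel)"
          by (rule ltr) measurable
        finally show ?thesis by simp
      qed
      then show ?thesis
        by (simp only:) (subst nn_integral_multc, auto)
    qed
    also have "\<dots> = (\<integral>\<^sup>+y. (\<integral>\<^sup>+x. ?a x * ?b (x + y) \<partial>\<nu>) \<partial>lborel)"
      by (rule Fubini'[symmetric]) measurable
    also have "\<dots> = (\<integral>\<^sup>+y. (\<integral>\<^sup>+x. ?a (x - y) * ?b x \<partial>\<nu>) \<partial>lborel)"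
    proof (rule nn_integral_cong)
      fix y :: 'a
      show "(\<integral>\<^sup>+x. ?a x * ?b (x + y) \<partial>\<nu>) = (\<integral>\<^sup>+x. ?a (x - y) * ?b x \<partial>\<nu>)"
        using trans[of "\<lambda>x. ?a (x - y) * ?b x" y] by simp
    qed
    also have "\<dots> = (\<integral>\<^sup>+x. (\<integral>\<^sup>+y. ?a (x - y) * ?b x \<partial>lborel) \<partial>\<nu>)"
      by (rule Fubini') measurable
    also have "\<dots> = emeasure lborel A * emeasure \<nu> D"
    proof -
      have "(\<integral>\<^sup>+y. ?a (x - y) * ?b x \<partial>lborel) = emeasure lborel A * ?b x" for x
      proof -
        have "(\<integral>\<^sup>+y. ?a (x - y) * ?b x \<partial>lborel) = (\<integral>\<^sup>+y. ?a (x - y) \<partial>lborel) * ?b x"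
          by (rule nn_integral_multc) measurable
        also have "(\<integral>\<^sup>+y. ?a (x - y) \<partial>lborel) = (\<integral>\<^sup>+y. ?a y \<partial>lborel)"
          by (rule lneg) measurable
        finally show ?thesis by simp
      qed
      then show ?thesis
        by (simp only:) (subst nn_integral_cmult, auto)
    qed
    finally have "emeasure \<nu> A * emeasure lborel D = emeasure lborel A * emeasure lborel D"
      by (simp add: ball D_def)
    moreover have "emeasure lborel D \<noteq> 0"
      using content_ball_pos[of 1 "0 :: 'a"] by (auto simp: measure_def D_def)
    moreover have "emeasure lborel D \<noteq> \<infinity>"
      using emeasure_lborel_ball_finite[of "0 :: 'a" 1] by (auto simp: D_def)
    ultimately show "emeasure \<nu> A = emeasure lborel A"
      by (metis mult_divide_eq_ennreal infinity_ennreal_def)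
  qed simp
  then show ?thesis by (simp add: \<nu>_def)
qed

lemma sphere_haar_measure_exists:
  "\<exists>\<mu> :: (real ^ 'n) measure. sphere_haar_measure \<mu>"
proof -
  let ?B = "ball (0 :: real ^ 'n) 1"
  define U where "U = uniform_measure lborel ?B"
  have sU[simp, measurable_cong]: "sets U = sets borel" and spU[simp]: "space U = UNIV"
    by (simp_all add: U_def)
  have pos: "emeasure lborel ?B \<noteq> 0"
    using emeasure_lborel_ball_finite content_ball_pos[of 1 "0 :: real ^ 'n"]
    by (auto simp: measure_def)
  have fin: "emeasure lborel ?B \<noteq> \<infinity>"
    using emeasure_lborel_ball_finite[of "0 :: real ^ 'n" 1] by auto
  interpret U: prob_space U
    unfolding U_def using pos fin by (rule prob_space_uniform_measure)
  have sgn[measurable]: "(sgn :: real ^ 'n \<Rightarrow> real ^ 'n) \<in> borel_measurable borel"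
    unfolding sgn_div_norm by measurable
  define \<mu> where "\<mu> = distr U borel sgn"
  have "prob_space \<mu>"
    unfolding \<mu>_def by (rule U.prob_space_distr) simp
  moreover have "sets \<mu> = sets borel"
    by (simp add: \<mu>_def)
  moreover have "emeasure \<mu> (sphere 0 1) = 1"
  proof -
    have "emeasure U {0} = 0"
      by (simp add: U_def)
    then have "AE x in U. x \<noteq> 0"
      by (intro AE_I[of _ _ "{0}"]) auto
    then have "AE x in U. sgn x \<in> sphere 0 1"
      by eventually_elim (simp add: norm_sgn)
    then have "AE x in \<mu>. x \<in> sphere 0 1"
      unfolding \<mu>_def by (subst AE_distr_iff) auto
    then show ?thesis
      using prob_space.emeasure_eq_1_AE[OF \<open>prob_space \<mu>\<close>] \<open>sets \<mu> = sets borel\<close> by auto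
  qed
  moreover have "distr \<mu> borel f = \<mu>" if f: "orthogonal_transformation f" for f
  proof -
    have lin: "linear f" and nf: "\<And>x. norm (f x) = norm x"
      using f by (auto simp: orthogonal_transformation)
    have fm[measurable]: "f \<in> borel_measurable borel"
      using lin by (intro borel_measurable_continuous_onI linear_continuous_on)
        (simp add: linear_conv_bounded_linear)
    have "distr U borel f = U"
    proof (rule measure_eqI)
      fix A assume "A \<in> sets (distr U borel f)"
      then have A[measurable]: "A \<in> sets borel" by simp
      have "emeasure lborel (?B \<inter> A) = emeasure (distr lborel borel f) (?B \<inter> A)"
        by (simp add: distr_lborel_orthogonal_transformation[OF f])
      also have "\<dots> = emeasure lborel (f -` (?B \<inter> A))"
        by (simp add: emeasure_distr)
      also have "f -` (?B \<inter> A) = ?B \<inter> f -` A"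
        by (auto simp: nf)
      finally have "emeasure lborel (?B \<inter> f -` A) = emeasure lborel (?B \<inter> A)" ..
      then show "emeasure (distr U borel f) A = emeasure U A"
        using measurable_sets_borel[OF fm A] by (simp add: emeasure_distr U_def)
    qed simp
    moreover have "f \<circ> sgn = sgn \<circ> f"
      by (auto simp: fun_eq_iff sgn_div_norm nf linear_scale[OF lin])
    moreover have "distr (distr U borel sgn) borel f = distr U borel (f \<circ> sgn)"
      by (rule distr_distr) auto
    moreover have "distr (distr U borel f) borel sgn = distr U borel (sgn \<circ> f)"
      by (rule distr_distr) auto
    ultimately show ?thesis
      unfolding \<mu>_def by simp
  qed
  ultimately show ?thesis
    unfolding sphere_haar_measure_def by blast
qed

end

theory Submission
  imports Defs
begin

text \<open>
  Write \<open>N = n + 1\<close> for the number of vertices of the simplex. Let \<open>u\<^sub>1, \<dots>, u\<^sub>N\<close> be vectors with sum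
  zero; when they are the facet normals of a simplex, every body \<open>Q\<close> has a circumscribed simplex
  \<open>{x. \<forall>i. x \<bullet> u\<^sub>i \<le> h\<^sub>Q(u\<^sub>i)}\<close> of size \<open>S(Q) = (\<Sum>i. h\<^sub>Q(u\<^sub>i))\<close>, and
  \<open>S(Q) - h\<^sub>Q(u\<^sub>i) - h\<^sub>Q(- u\<^sub>i) \<ge> 0\<close> measures by how much \<open>Q\<close> misses its \<open>i\<close>-th vertex. The sum of these
  defects, \<open>(N - 1) * (\<Sum>i. h\<^sub>Q(u\<^sub>i)) - (\<Sum>i. h\<^sub>Q(- u\<^sub>i))\<close>, is linear in \<open>h\<^sub>Q\<close>, and it vanishes when \<open>Q\<close> is
  the simplex itself.

  The heart of the proof, \<open>depth_class_gap\<close>, is that a body of depth \<open>d\<close> with \<open>2 ^ d < N\<close> has total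
  defect at least \<open>S(Q) / N ^ d\<close>. Both sides are additive under Minkowski sums, so this only has to be
  shown for \<open>Q = conv (K \<union> L)\<close>. If the defect of \<open>Q\<close> were smaller, each vertex of the circumscribed
  simplex would almost be reached, by \<open>K\<close> or by \<open>L\<close>. One of them reaches more than \<open>2 ^ (d - 1)\<close> vertices.
  Projecting all other vertices onto one of these makes that body nearly a simplex with more than
  \<open>2 ^ (d - 1)\<close> vertices, contradicting the bound for depth \<open>d - 1\<close> (\<open>gap_from_large_piece\<close>). This is a
  quantitative form of the fact that a simplex is indecomposable, hence it bounds the distance to
  Minkowski sums with arbitrarily many summands.

  The gap inequality is linear in the support function, and the simplex violates it for
  \<open>u\<^sub>i = - v\<^sub>i\<close>, where \<open>v\<^sub>i\<close> are its vertices. So \<open>h\<^sub>P\<close> and \<open>h\<^sub>\<Delta>\<close> differ noticeably in one of finitely many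
  directions. To obtain a difference on average, the directions are perturbed to \<open>- v\<^sub>i + c\<^sub>i z\<close> with
  \<open>(\<Sum>i. c\<^sub>i) = 0\<close> and all \<open>c\<^sub>i \<noteq> 0\<close>: the sum stays zero, and as \<open>z\<close> runs through a small ball every
  direction sweeps out a ball (\<open>simplex_violates_gap\<close>). Integrating over \<open>z\<close> bounds the Lebesgue integral of
  \<open>\<bar>h\<^sub>P - h\<^sub>\<Delta>\<bar>\<close> over a ball from below, and because this function is positively homogeneous and the uniform
  measure on the sphere is the only rotation-invariant one, that integral is controlled by the mean over
  the sphere (\<open>ball_integral_le_sphere_integral\<close>). All constants depend on \<open>n\<close> alone.
\<close>

section \<open>Calculus of support functions\<close>

lemma support_fun_eqI:
  assumes "y \<in> P" "\<And>z. z \<in> P \<Longrightarrow> x \<bullet> z \<le> x \<bullet> y"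
  shows "support_fun P x = x \<bullet> y"
  unfolding support_fun_def using assms by (intro cSup_eq_maximum) auto

lemma support_fun_upper:
  assumes "compact P" "z \<in> P"
  shows "x \<bullet> z \<le> support_fun P x"
  using support_fun_attained[OF assms(1), of x] assms(2) by force

lemma support_fun_le:
  assumes "compact P" "P \<noteq> {}" "\<And>z. z \<in> P \<Longrightarrow> x \<bullet> z \<le> b"
  shows "support_fun P x \<le> b"
  using support_fun_attained[OF assms(1,2), of x] assms(3) by force

lemma support_fun_set_plus:
  assumes "compact A" "A \<noteq> {}" "compact B" "B \<noteq> {}"
  shows "support_fun (A + B) x = support_fun A x + support_fun B x"
proof -
  obtain a where a: "a \<in> A" "support_fun A x = x \<bullet> a" "\<And>z. z \<in> A \<Longrightarrow> x \<bullet> z \<le> x \<bullet> a"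
    using support_fun_attained[OF assms(1,2), of x] by blast
  obtain b where b: "b \<in> B" "support_fun B x = x \<bullet> b" "\<And>z. z \<in> B \<Longrightarrow> x \<bullet> z \<le> x \<bullet> b"
    using support_fun_attained[OF assms(3,4), of x] by blast
  have "support_fun (A + B) x = x \<bullet> (a + b)"
    using a b by (intro support_fun_eqI) (auto simp: set_plus_def inner_add_right intro!: add_mono)
  with a b show ?thesis by (simp add: inner_add_right)
qed

lemma compact_set_plus:
  fixes A B :: "'a::euclidean_space set"
  assumes "compact A" "compact B"
  shows "compact (A + B)"
proof -
  have "A + B = {x + y | x y. x \<in> A \<and> y \<in> B}"
    by (auto simp: set_plus_def)
  then show ?thesis using compact_sums[OF assms] by simp
qed

lemma support_fun_set_sum:
  fixes Q :: "'j \<Rightarrow> 'a::euclidean_space set"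
  assumes "finite J" "\<And>j. j \<in> J \<Longrightarrow> compact (Q j) \<and> Q j \<noteq> {}"
  shows "compact (sum Q J) \<and> sum Q J \<noteq> {} \<and>
    support_fun (sum Q J) x = (\<Sum>j\<in>J. support_fun (Q j) x)"
  using assms
proof (induction J rule: finite_induct)
  case empty
  show ?case by (simp add: set_zero support_fun_def)
next
  case (insert j J)
  then have IH: "compact (sum Q J)" "sum Q J \<noteq> {}"
    "support_fun (sum Q J) x = (\<Sum>j\<in>J. support_fun (Q j) x)" "compact (Q j)" "Q j \<noteq> {}"
    by auto
  then show ?case
    using insert.hyps
    using support_fun_set_plus[OF IH(4,5,1,2), of x] compact_set_plus[OF IH(4,1)]
      set_plus_intro[of _ "Q j" _ "sum Q J"] by auto
qed

lemma hull_inner_le: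
  assumes "z \<in> convex hull K" "\<And>y. y \<in> K \<Longrightarrow> x \<bullet> y \<le> b"
  shows "x \<bullet> z \<le> b"
proof -
  have "convex hull K \<subseteq> {y. x \<bullet> y \<le> b}"
    using assms(2) by (intro hull_minimal convex_halfspace_le) auto
  with assms(1) show ?thesis by auto
qed

lemma support_fun_hull:
  assumes "compact K" "K \<noteq> {}"
  shows "support_fun (convex hull K) x = support_fun K x"
proof -
  obtain y where y: "y \<in> K" "support_fun K x = x \<bullet> y" "\<And>z. z \<in> K \<Longrightarrow> x \<bullet> z \<le> x \<bullet> y"
    using support_fun_attained[OF assms, of x] by blast
  have "support_fun (convex hull K) x = x \<bullet> y"
    using y by (intro support_fun_eqI) (auto intro: hull_inc hull_inner_le)
  with y show ?thesis by simp
qed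

lemma support_fun_Lipschitz:
  assumes "compact P" "P \<noteq> {}" "\<And>y. y \<in> P \<Longrightarrow> norm y \<le> B"
  shows "support_fun P x \<le> support_fun P x' + B * norm (x - x')"
proof (rule support_fun_le[OF assms(1,2)])
  fix z assume z: "z \<in> P"
  have "x \<bullet> z = x' \<bullet> z + (x - x') \<bullet> z"
    by (simp add: inner_diff_left)
  also have "(x - x') \<bullet> z \<le> norm (x - x') * norm z"
    by (rule norm_cauchy_schwarz)
  also have "\<dots> \<le> norm (x - x') * B"
    using assms(3)[OF z] by (intro mult_left_mono) auto
  finally show "x \<bullet> z \<le> support_fun P x' + B * norm (x - x')"
    using support_fun_upper[OF assms(1) z, of x'] by (simp add: mult.commute)
qed

lemma continuous_support_fun:
  fixes P :: "'a::euclidean_space set"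
  assumes "compact P" "P \<noteq> {}"
  shows "continuous_on UNIV (support_fun P)"
proof -
  obtain B where B: "\<And>y. y \<in> P \<Longrightarrow> norm y \<le> B"
    using compact_imp_bounded[OF assms(1)] by (auto simp: bounded_iff)
  obtain y where "y \<in> P" using assms(2) by blast
  then have "0 \<le> B" using B order_trans[OF norm_ge_zero] by blast
  have "B-lipschitz_on UNIV (support_fun P)"
  proof (rule lipschitz_onI)
    fix x x' :: 'a
    show "dist (support_fun P x) (support_fun P x') \<le> B * dist x x'"
      using support_fun_Lipschitz[OF assms B, of x x'] support_fun_Lipschitz[OF assms B, of x' x]
      by (simp add: dist_norm norm_minus_commute abs_le_iff)
  qed fact
  then show ?thesis by (rule lipschitz_on_continuous_on)
qed

lemma support_fun_scaleR:
  assumes "compact P" "P \<noteq> {}" "0 \<le> c"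
  shows "support_fun P (c *\<^sub>R x) = c * support_fun P x"
proof -
  obtain y where y: "y \<in> P" "support_fun P x = x \<bullet> y" "\<And>z. z \<in> P \<Longrightarrow> x \<bullet> z \<le> x \<bullet> y"
    using support_fun_attained[OF assms(1,2), of x] by blast
  have "support_fun P (c *\<^sub>R x) = (c *\<^sub>R x) \<bullet> y"
    using y assms(3) by (intro support_fun_eqI) (auto intro: mult_left_mono)
  with y show ?thesis by simp
qed

lemma support_fun_sum_nonneg:
  assumes "compact P" "P \<noteq> {}" "(\<Sum>i\<in>I. u i) = 0"
  shows "0 \<le> (\<Sum>i\<in>I. support_fun P (u i))"
proof -
  obtain y where "y \<in> P" using assms(2) by blast
  then have "(\<Sum>i\<in>I. u i \<bullet> y) \<le> (\<Sum>i\<in>I. support_fun P (u i))"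
    using assms(1) by (intro sum_mono support_fun_upper)
  then show ?thesis
    using assms(3) by (simp flip: inner_sum_left)
qed

section \<open>Low depth forces a distance from simplices\<close>

lemma depth_class_compact:
  assumes "P \<in> depth_class d"
  shows "compact P \<and> P \<noteq> {}"
  using assms
proof (induction d arbitrary: P)
  case 0
  then show ?case by auto
next
  case (Suc d)
  then obtain m :: nat and K L where P: "P = (\<Sum>j\<in>{1..m}. convex hull (K j \<union> L j))"
    and KL: "\<forall>j\<in>{1..m}. K j \<in> depth_class d \<and> L j \<in> depth_class d"
    by auto
  have "compact (convex hull (K j \<union> L j)) \<and> convex hull (K j \<union> L j) \<noteq> {}" if "j \<in> {1..m}" for j
    using KL that Suc.IH by (auto intro!: compact_convex_hull compact_Un)
  then show ?case
    unfolding P using support_fun_set_sum[of "{1..m}" "\<lambda>j. convex hull (K j \<union> L j)"] by simp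
qed

text \<open>
  Here \<open>X\<close> plays the role of \<open>K\<close> or \<open>L\<close> inside \<open>Q = conv (K \<union> L)\<close>, and \<open>J\<close> is the set of vertices for which
  the support of \<open>Q\<close> is attained in \<open>X\<close>. The new directions \<open>w\<close> in the proof are dual to the linear map
  that fixes the vertices in \<open>J\<close> and sends all others to the vertex \<open>i0\<close>. A projection is used rather than
  a passage to the face spanned by \<open>J\<close>, since a body that is only close to a simplex may have a single
  point as its face in the relevant direction.
\<close>

lemma gap_from_large_piece:
  fixes u :: "'i \<Rightarrow> 'a::euclidean_space" and \<delta> :: real
  assumes I: "finite I" "card I \<le> M" "J \<subseteq> I" "2 \<le> card J" and u0: "(\<Sum>i\<in>I. u i) = 0"
    and Q: "compact Q" and X: "compact X" "X \<noteq> {}" "X \<subseteq> Q"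
    and y: "\<And>i. i \<in> J \<Longrightarrow> y i \<in> X \<and> support_fun Q (- u i) = - u i \<bullet> y i"
    and \<delta>: "0 \<le> \<delta>" "\<delta> \<le> 1"
    and gap: "\<And>w. (\<Sum>i\<in>J. w i) = 0 \<Longrightarrow> (\<Sum>i\<in>J. support_fun X (- w i)) \<le>
      (real (card J) - 1 - \<delta>) * (\<Sum>i\<in>J. support_fun X (w i))"
  shows "(\<Sum>i\<in>I. support_fun Q (- u i)) \<le>
    (real (card I) - 1 - \<delta> / M) * (\<Sum>i\<in>I. support_fun Q (u i))"
proof (rule ccontr)
  define h where "h = support_fun Q"
  define S where "S = (\<Sum>i\<in>I. h (u i))"
  define \<epsilon> where "\<epsilon> = \<delta> / M"
  assume "\<not> ?thesis"
  then have neg: "(real (card I) - 1 - \<epsilon>) * S < (\<Sum>i\<in>I. h (- u i))"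
    by (simp add: S_def \<epsilon>_def h_def)
  have [simp]: "finite J" using I finite_subset by blast
  have cJ: "card J \<le> card I" using I by (intro card_mono) auto
  have Q0: "Q \<noteq> {}" using X by auto
  have S0: "0 \<le> S"
    unfolding S_def h_def by (rule support_fun_sum_nonneg[OF Q Q0 u0])
  have up: "x \<bullet> z \<le> h x" if "z \<in> Q" for x z
    unfolding h_def by (rule support_fun_upper[OF Q that])
  have split: "S = h (u i) + (\<Sum>j\<in>I-{i}. h (u j))" "u i = - (\<Sum>j\<in>I-{i}. u j)" if "i \<in> I" for i
    using that I u0 by (simp_all add: S_def sum.remove eq_neg_iff_add_eq_0)
  \<comment> \<open>The defects are nonnegative because \<open>- u i\<close> is the sum of the other directions; so a small total bounds each one.\<close>
  have defect: "0 \<le> S - h (u i) - h (- u i)" if "i \<in> I" for i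
  proof -
    have "h (- u i) \<le> (\<Sum>j\<in>I-{i}. h (u j))"
      unfolding h_def
    proof (rule support_fun_le[OF Q Q0])
      fix z assume "z \<in> Q"
      then have "(\<Sum>j\<in>I-{i}. u j \<bullet> z) \<le> (\<Sum>j\<in>I-{i}. h (u j))"
        by (intro sum_mono up)
      then show "- u i \<bullet> z \<le> (\<Sum>j\<in>I-{i}. support_fun Q (u j))"
        using split(2)[OF that] by (simp add: inner_sum_left h_def)
    qed
    with split(1)[OF that] show ?thesis by simp
  qed
  have small: "S - h (u i) - h (- u i) < \<epsilon> * S" if "i \<in> I" for i
  proof -
    have "S - h (u i) - h (- u i) \<le> (\<Sum>i\<in>I. S - h (u i) - h (- u i))"
      using that I defect by (intro member_le_sum) auto
    also have "\<dots> = real (card I) * S - S - (\<Sum>i\<in>I. h (- u i))"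
      by (simp add: sum_subtractf S_def)
    also have "\<dots> < \<epsilon> * S"
      using neg by (simp add: algebra_simps)
    finally show ?thesis .
  qed
  obtain i0 where i0: "i0 \<in> J" using I(4) by force
  define w where "w i = u i + (if i = i0 then \<Sum>j\<in>I-J. u j else 0)" for i
  define b where "b i = h (u i) + (if i = i0 then \<Sum>j\<in>I-J. h (u j) else 0)" for i
  have w0: "(\<Sum>i\<in>J. w i) = 0"
    using i0 u0 I sum.subset_diff[OF I(3,1), of u] by (simp add: w_def sum.distrib add.commute)
  have bS: "(\<Sum>i\<in>J. b i) = S"
    using i0 I sum.subset_diff[OF I(3,1), of "\<lambda>i. h (u i)"]
    by (simp add: b_def S_def sum.distrib add.commute)
  have rest: "(\<Sum>j\<in>I-J. u j) \<bullet> z \<le> (\<Sum>j\<in>I-J. h (u j))" if "z \<in> Q" for z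
    unfolding inner_sum_left using that by (intro sum_mono up)
  have hi: "support_fun X (w i) \<le> b i" for i
  proof (rule support_fun_le[OF X(1,2)])
    fix z assume "z \<in> X"
    then have "z \<in> Q" using X by auto
    then show "w i \<bullet> z \<le> b i"
      using rest[of z] up[of z "u i"] by (auto simp: w_def b_def inner_add_left)
  qed
  \<comment> \<open>The point \<open>y i\<close> nearly attains all bounds \<open>h (u j)\<close> with \<open>j \<noteq> i\<close>, since its defect is small.\<close>
  have lo: "S - b i - \<epsilon> * S < support_fun X (- w i)" if "i \<in> J" for i
  proof -
    have yi: "y i \<in> X" "y i \<in> Q" "h (- u i) = - (u i \<bullet> y i)"
      using y[OF that] X by (auto simp: h_def)
    have "S - b i - \<epsilon> * S < - w i \<bullet> y i"
      using small[of i] that I(3) rest[OF yi(2)] yi(3)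
      by (auto simp: w_def b_def inner_add_left inner_diff_left)
    also have "\<dots> \<le> support_fun X (- w i)"
      by (rule support_fun_upper[OF X(1) yi(1)])
    finally show ?thesis .
  qed
  have "(\<Sum>i\<in>J. S - b i - \<epsilon> * S) < (\<Sum>i\<in>J. support_fun X (- w i))"
    using lo i0 by (intro sum_strict_mono) auto
  also have "\<dots> \<le> (real (card J) - 1 - \<delta>) * (\<Sum>i\<in>J. support_fun X (w i))"
    by (rule gap[OF w0])
  also have "\<dots> \<le> (real (card J) - 1 - \<delta>) * S"
    unfolding bS[symmetric] using I(4) \<delta> by (intro mult_left_mono sum_mono hi) auto
  finally have "real (card J) * S - S - real (card J) * (\<epsilon> * S) < (real (card J) - 1 - \<delta>) * S"
    by (simp add: sum_subtractf bS)
  then have "\<delta> * S < real (card J) * (\<epsilon> * S)"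
    by (simp add: algebra_simps)
  also have "\<dots> \<le> real M * (\<epsilon> * S)"
    using \<delta> S0 I cJ by (intro mult_right_mono) (auto simp: \<epsilon>_def)
  also have "\<dots> = \<delta> * S"
    using I cJ by (simp add: \<epsilon>_def)
  finally show False by simp
qed

text \<open>
  The bound \<open>M\<close> on the number of directions stays the same throughout the induction on \<open>d\<close>, whereas \<open>I\<close>
  shrinks to the subset provided by the pigeonhole principle. The directions are only tied
  by \<open>(\<Sum>i\<in>I. u i) = 0\<close>, so that the induction hypothesis applies to the collapsed ones, which span
  a smaller space.
\<close>

lemma depth_class_gap:
  fixes u :: "'i \<Rightarrow> 'a::euclidean_space"
  assumes "finite I" "card I \<le> M" "2 ^ d < card I" "(\<Sum>i\<in>I. u i) = 0" "P \<in> depth_class d"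
  shows "(\<Sum>i\<in>I. support_fun P (- u i)) \<le>
    (real (card I) - 1 - 1 / M ^ d) * (\<Sum>i\<in>I. support_fun P (u i))"
  using assms
proof (induction d arbitrary: I u P)
  case 0
  then obtain x where P: "P = {x}" by auto
  have "support_fun P v = v \<bullet> x" for v
    unfolding P by (rule support_fun_eqI) auto
  then show ?case
    using 0 by (simp add: sum_negf flip: inner_sum_left)
next
  case (Suc d)
  obtain m :: nat and K L where P: "P = (\<Sum>j\<in>{1..m}. convex hull (K j \<union> L j))"
    and KL: "\<And>j. j \<in> {1..m} \<Longrightarrow> K j \<in> depth_class d \<and> L j \<in> depth_class d"
    using Suc.prems(5) by auto
  let ?Q = "\<lambda>j. convex hull (K j \<union> L j)"
  let ?c = "real (card I) - 1 - 1 / real M ^ Suc d"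
  have cmp: "compact (K j)" "K j \<noteq> {}" "compact (L j)" "L j \<noteq> {}" if "j \<in> {1..m}" for j
    using KL[OF that] depth_class_compact by auto
  have Qc: "compact (?Q j) \<and> ?Q j \<noteq> {}" if "j \<in> {1..m}" for j
    using cmp[OF that] by (auto intro!: compact_convex_hull compact_Un)
  have sumP: "support_fun P x = (\<Sum>j\<in>{1..m}. support_fun (?Q j) x)" for x
    unfolding P using support_fun_set_sum[of "{1..m}" ?Q] Qc by blast
  have hullgap: "(\<Sum>i\<in>I. support_fun (?Q j) (- u i)) \<le> ?c * (\<Sum>i\<in>I. support_fun (?Q j) (u i))"
    if j: "j \<in> {1..m}" for j
  proof -
    have "\<exists>y. y \<in> K j \<union> L j \<and> support_fun (?Q j) (- u i) = - u i \<bullet> y" for i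
    proof -
      have KL': "compact (K j \<union> L j)" "K j \<union> L j \<noteq> {}"
        using cmp[OF j] by (auto intro: compact_Un)
      show ?thesis
        using support_fun_attained[OF KL', of "- u i"] support_fun_hull[OF KL', of "- u i"] by metis
    qed
    then obtain y where y: "\<And>i. y i \<in> K j \<union> L j" "\<And>i. support_fun (?Q j) (- u i) = - u i \<bullet> y i"
      by metis
    have half: ?thesis if X: "X = K j \<or> X = L j" and J: "J = {i\<in>I. y i \<in> X}" "2 ^ d < card J" for X J
    proof -
      have Xd: "X \<in> depth_class d" using X KL[OF j] by auto
      have "(\<Sum>i\<in>I. support_fun (?Q j) (- u i)) \<le>
          (real (card I) - 1 - (1 / M ^ d) / M) * (\<Sum>i\<in>I. support_fun (?Q j) (u i))"
      proof (rule gap_from_large_piece[where J = J and X = X and y = y])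
        show "2 \<le> card J"
          using J(2) one_le_power[of "2::nat" d] by linarith
        show "X \<subseteq> ?Q j"
          using X by (auto intro: hull_inc)
        have cJ: "card J \<le> card I"
          using Suc.prems(1) J by (intro card_mono) auto
        show "(\<Sum>i\<in>J. support_fun X (- w i)) \<le>
            (real (card J) - 1 - 1 / M ^ d) * (\<Sum>i\<in>J. support_fun X (w i))"
          if "(\<Sum>i\<in>J. w i) = 0" for w
          using Suc.IH[of J w X] that Xd J Suc.prems cJ by auto
        have "1 \<le> M" using Suc.prems by linarith
        then show "1 / real (M ^ d) \<le> 1"
          by simp
      qed (use Suc.prems J X y Qc[OF j] cmp[OF j] in auto)
      then show ?thesis by (simp add: mult.commute)
    qed
    have "I = {i\<in>I. y i \<in> K j} \<union> {i\<in>I. y i \<in> L j}"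
      using y by auto
    then have "card I \<le> card {i\<in>I. y i \<in> K j} + card {i\<in>I. y i \<in> L j}"
      by (metis card_Un_le)
    then have "2 ^ d < card {i\<in>I. y i \<in> K j} \<or> 2 ^ d < card {i\<in>I. y i \<in> L j}"
      using Suc.prems(3) by auto
    then show ?thesis using half by blast
  qed
  have "(\<Sum>i\<in>I. support_fun P (- u i)) = (\<Sum>j\<in>{1..m}. \<Sum>i\<in>I. support_fun (?Q j) (- u i))"
    unfolding sumP by (rule sum.swap)
  also have "\<dots> \<le> (\<Sum>j\<in>{1..m}. ?c * (\<Sum>i\<in>I. support_fun (?Q j) (u i)))"
    by (intro sum_mono hullgap)
  also have "\<dots> = ?c * (\<Sum>i\<in>I. support_fun P (u i))"
    unfolding sumP sum_distrib_left[symmetric] by (subst sum.swap) simp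
  finally show ?case .
qed

section \<open>Integrals over balls and over the sphere\<close>

lemma borel_measurable_sgn_vec [measurable]:
  "(sgn :: real ^ 'n \<Rightarrow> real ^ 'n) \<in> borel_measurable borel"
  unfolding sgn_div_norm by measurable

lemma borel_measurable_orthogonal:
  fixes g :: "'a::euclidean_space \<Rightarrow> 'a"
  assumes "orthogonal_transformation g"
  shows "g \<in> borel_measurable borel"
  using orthogonal_transformation_linear[OF assms]
  by (intro borel_measurable_continuous_onI linear_continuous_on) (simp add: linear_conv_bounded_linear)

text \<open>
  The image of \<open>\<rho>\<close> under \<open>sgn\<close> is rotation-invariant on the sphere, hence a multiple of \<open>\<mu>\<close>; this is the
  half of that uniqueness statement that gives an upper bound. The kernel
  \<open>k x y\<close>, the indicator of \<open>dist x (sgn y) < \<delta>\<close>, is invariant under simultaneous rotation of \<open>x\<close> and \<open>y\<close>.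
  As rotations act transitively on the sphere, integrating it over \<open>x\<close> or over \<open>y\<close> gives constants \<open>c\<close>
  and \<open>c'\<close>. Applying Fubini's theorem to \<open>k\<close> alone identifies \<open>c'\<close> as \<open>c\<close> times the mass of \<open>\<rho>\<close>.
  Applying it to \<open>k\<close> times \<open>f\<close>, where on the support of \<open>k\<close> the argument \<open>sgn y\<close> may be replaced by
  \<open>x\<close> at the cost of \<open>\<omega>\<close>, compares the two integrals.
\<close>

lemma sphere_haar_integral_comparison:
  fixes \<mu> \<rho> :: "(real ^ 'n) measure" and f :: "real ^ 'n \<Rightarrow> real"
  assumes \<mu>: "sphere_haar_measure \<mu>"
    and \<rho>: "finite_measure \<rho>" "sets \<rho> = sets borel" "AE y in \<rho>. y \<noteq> 0"
      "\<And>g. orthogonal_transformation g \<Longrightarrow> distr \<rho> borel g = \<rho>"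
    and f: "continuous_on UNIV f" "\<And>x. 0 \<le> f x"
  shows "(\<integral>\<^sup>+y. ennreal (f (sgn y)) \<partial>\<rho>) \<le> emeasure \<rho> UNIV * (\<integral>\<^sup>+x. ennreal (f x) \<partial>\<mu>)"
proof -
  have \<mu>p: "prob_space \<mu>" and s\<mu>[simp, measurable_cong]: "sets \<mu> = sets borel"
    and \<mu>s: "emeasure \<mu> (sphere 0 1) = 1"
    and \<mu>i: "\<And>g. orthogonal_transformation g \<Longrightarrow> distr \<mu> borel g = \<mu>"
    using \<mu> unfolding sphere_haar_measure_def by auto
  interpret \<mu>: prob_space \<mu> by fact
  interpret \<rho>: finite_measure \<rho> by fact
  interpret pair_sigma_finite \<mu> \<rho> ..
  note \<rho>(2)[simp, measurable_cong]
  have sp[simp]: "space \<mu> = UNIV" "space \<rho> = UNIV"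
    using sets_eq_imp_space_eq[OF s\<mu>] sets_eq_imp_space_eq[OF \<rho>(2)] by auto
  have [measurable]: "f \<in> borel_measurable borel"
    using f(1) by (rule borel_measurable_continuous_onI)
  have sphereAE: "AE x in \<mu>. norm x = 1"
    using \<mu>.AE_prob_1[of "sphere 0 1"] \<mu>s by (simp add: \<mu>.emeasure_eq_measure dist_norm)
  let ?I = "\<integral>\<^sup>+y. ennreal (f (sgn y)) \<partial>\<rho>" and ?J = "\<integral>\<^sup>+x. ennreal (f x) \<partial>\<mu>"
  let ?m = "emeasure \<rho> UNIV"
  have approx: "?I \<le> ?m * (?J + ennreal \<omega>)" if \<omega>: "\<omega> > 0" for \<omega>
  proof -
    have "uniformly_continuous_on (sphere 0 1) f"
      using f(1) by (intro compact_uniformly_continuous) (auto intro: continuous_on_subset)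
    then obtain \<delta> where \<delta>: "\<delta> > 0"
      and close: "\<And>x x'. norm x = 1 \<Longrightarrow> norm x' = 1 \<Longrightarrow> dist x x' < \<delta> \<Longrightarrow> dist (f x) (f x') < \<omega>"
      using \<omega> unfolding uniformly_continuous_on_def
      by (metis dist_commute mem_sphere_0)
    define k :: "real ^ 'n \<Rightarrow> real ^ 'n \<Rightarrow> ennreal"
      where "k x y = indicator {p. dist (fst p) (sgn (snd p)) < \<delta>} (x, y)" for x y
    have kset[measurable]: "{p :: (real^'n) \<times> (real^'n). dist (fst p) (sgn (snd p)) < \<delta>} \<in> sets (borel \<Otimes>\<^sub>M borel)"
    proof -
      have "{p \<in> space (borel \<Otimes>\<^sub>M borel). dist (fst p :: real^'n) (sgn (snd p)) < \<delta>} \<in> sets (borel \<Otimes>\<^sub>M borel)"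
        by measurable
      then show ?thesis by (simp add: space_pair_measure)
    qed
    have [measurable]: "case_prod k \<in> borel_measurable (borel \<Otimes>\<^sub>M borel)"
      unfolding k_def case_prod_beta prod.collapse by measurable
    obtain e :: "real ^ 'n" where e: "norm e = 1"
      using vector_choose_size[of 1] by auto
    define c where "c = emeasure \<mu> (ball e \<delta>)"
    define c' where "c' = emeasure \<rho> {y. dist e (sgn y) < \<delta>}"
    have c: "emeasure \<mu> (ball a \<delta>) = c" if a: "norm a = 1" for a
    proof -
      obtain g where g: "orthogonal_transformation g" "g e = a"
        using orthogonal_transformation_exists[of e a] a e by auto
      have [measurable]: "g \<in> borel_measurable borel"
        by (rule borel_measurable_orthogonal[OF g(1)])
      have "dist (g e) (g x) = dist e x" for x
        using orthogonal_transformation_linear[OF g(1)] orthogonal_transformation_norm[OF g(1)]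
        by (simp add: dist_norm flip: linear_diff)
      then have "g -` ball a \<delta> = ball e \<delta>"
        using g(2) by auto
      moreover have "emeasure (distr \<mu> borel g) (ball a \<delta>) = emeasure \<mu> (g -` ball a \<delta>)"
        by (simp add: emeasure_distr)
      ultimately show ?thesis
        by (simp add: \<mu>i[OF g(1)] c_def)
    qed
    have c': "emeasure \<rho> {y. dist a (sgn y) < \<delta>} = c'" if a: "norm a = 1" for a
    proof -
      obtain g where g: "orthogonal_transformation g" "g e = a"
        using orthogonal_transformation_exists[of e a] a e by auto
      have [measurable]: "g \<in> borel_measurable borel"
        by (rule borel_measurable_orthogonal[OF g(1)])
      have "dist (g e) (g x) = dist e x" for x
        using orthogonal_transformation_linear[OF g(1)] orthogonal_transformation_norm[OF g(1)]
        by (simp add: dist_norm flip: linear_diff)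
      moreover have "sgn (g y) = g (sgn y)" for y
        using g(1) by (simp add: sgn_div_norm orthogonal_transformation_norm
          linear_scale[OF orthogonal_transformation_linear])
      ultimately have "g -` {y. dist a (sgn y) < \<delta>} = {y. dist e (sgn y) < \<delta>}"
        using g(2) by auto
      moreover have "{y. dist a (sgn y) < \<delta>} \<in> sets borel"
        by measurable
      then have "emeasure (distr \<rho> borel g) {y. dist a (sgn y) < \<delta>} = emeasure \<rho> (g -` {y. dist a (sgn y) < \<delta>})"
        by (simp add: emeasure_distr)
      ultimately show ?thesis
        by (simp add: \<rho>(4)[OF g(1)] c'_def)
    qed
    \<comment> \<open>Finitely many balls of radius \<open>\<delta>\<close> cover the sphere, and all of them have measure \<open>c\<close>.\<close>
    have "c \<noteq> 0"
    proof
      assume c0: "c = 0"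
      obtain F where F: "F \<subseteq> sphere 0 1" "finite F" "sphere (0::real^'n) 1 \<subseteq> (\<Union>a\<in>F. ball a \<delta>)"
      proof (rule compactE_image[of "sphere (0::real^'n) 1" "sphere 0 1" "\<lambda>a. ball a \<delta>"])
        show "sphere (0::real^'n) 1 \<subseteq> (\<Union>a\<in>sphere 0 1. ball a \<delta>)"
          using \<delta> by force
      qed auto
      have "emeasure \<mu> (sphere 0 1) \<le> emeasure \<mu> (\<Union>a\<in>F. ball a \<delta>)"
        using F by (intro emeasure_mono) auto
      also have "\<dots> \<le> (\<Sum>a\<in>F. emeasure \<mu> (ball a \<delta>))"
        using F(2) by (intro emeasure_subadditive_finite) auto
      also have "\<dots> = 0"
        using F(1) c c0 by (intro sum.neutral) auto
      finally show False using \<mu>s by simp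
    qed
    have cfin: "c \<noteq> \<infinity>"
      unfolding c_def by (simp add: \<mu>.emeasure_eq_measure)
    have kx: "(\<integral>\<^sup>+x. k x y \<partial>\<mu>) = c" if "y \<noteq> 0" for y
    proof -
      have "(\<integral>\<^sup>+x. k x y \<partial>\<mu>) = (\<integral>\<^sup>+x. indicator (ball (sgn y) \<delta>) x \<partial>\<mu>)"
        by (intro nn_integral_cong) (auto simp: k_def indicator_def dist_commute)
      then show ?thesis
        using c[of "sgn y"] that by (simp add: norm_sgn)
    qed
    have ky: "(\<integral>\<^sup>+y. k x y \<partial>\<rho>) = c'" if "norm x = 1" for x
    proof -
      have "(\<integral>\<^sup>+y. k x y \<partial>\<rho>) = (\<integral>\<^sup>+y. indicator {y. dist x (sgn y) < \<delta>} y \<partial>\<rho>)"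
        by (intro nn_integral_cong) (auto simp: k_def indicator_def)
      also have "\<dots> = emeasure \<rho> {y. dist x (sgn y) < \<delta>}"
        by (rule nn_integral_indicator) measurable
      finally show ?thesis
        using c'[OF that] by simp
    qed
    have "c * ?m = (\<integral>\<^sup>+y. c \<partial>\<rho>)"
      by simp
    also have "\<dots> = (\<integral>\<^sup>+y. (\<integral>\<^sup>+x. k x y \<partial>\<mu>) \<partial>\<rho>)"
      using \<rho>(3) by (intro nn_integral_cong_AE) (auto simp: kx)
    also have "\<dots> = (\<integral>\<^sup>+x. (\<integral>\<^sup>+y. k x y \<partial>\<rho>) \<partial>\<mu>)"
      by (rule Fubini') measurable
    also have "\<dots> = (\<integral>\<^sup>+x. c' \<partial>\<mu>)"
      using sphereAE by (intro nn_integral_cong_AE) (auto simp: ky)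
    also have "\<dots> = c'"
      using \<mu>.emeasure_space_1 by simp
    finally have cc': "c' = c * ?m" ..
    have "c * ?I = (\<integral>\<^sup>+y. c * ennreal (f (sgn y)) \<partial>\<rho>)"
      by (rule nn_integral_cmult[symmetric]) measurable
    also have "\<dots> = (\<integral>\<^sup>+y. (\<integral>\<^sup>+x. k x y * ennreal (f (sgn y)) \<partial>\<mu>) \<partial>\<rho>)"
      using \<rho>(3) by (intro nn_integral_cong_AE) (auto simp: kx nn_integral_multc)
    also have "\<dots> \<le> (\<integral>\<^sup>+y. (\<integral>\<^sup>+x. k x y * (ennreal (f x) + ennreal \<omega>) \<partial>\<mu>) \<partial>\<rho>)"
    proof (rule nn_integral_mono_AE)
      show "AE y in \<rho>. (\<integral>\<^sup>+x. k x y * ennreal (f (sgn y)) \<partial>\<mu>)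
          \<le> (\<integral>\<^sup>+x. k x y * (ennreal (f x) + ennreal \<omega>) \<partial>\<mu>)"
        using \<rho>(3)
      proof eventually_elim
        fix y :: "real ^ 'n" assume y: "y \<noteq> 0"
        show "(\<integral>\<^sup>+x. k x y * ennreal (f (sgn y)) \<partial>\<mu>)
          \<le> (\<integral>\<^sup>+x. k x y * (ennreal (f x) + ennreal \<omega>) \<partial>\<mu>)"
        proof (rule nn_integral_mono_AE)
          show "AE x in \<mu>. k x y * ennreal (f (sgn y)) \<le> k x y * (ennreal (f x) + ennreal \<omega>)"
            using sphereAE
          proof eventually_elim
            fix x :: "real ^ 'n" assume x: "norm x = 1"
            show "k x y * ennreal (f (sgn y)) \<le> k x y * (ennreal (f x) + ennreal \<omega>)"
            proof (cases "dist x (sgn y) < \<delta>")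
              case True
              then have "dist (f x) (f (sgn y)) < \<omega>"
                using close[of x "sgn y"] x y by (simp add: norm_sgn)
              then have "f (sgn y) \<le> f x + \<omega>"
                by (simp add: dist_real_def)
              then have "ennreal (f (sgn y)) \<le> ennreal (f x) + ennreal \<omega>"
                using f(2) \<omega> by (simp flip: ennreal_plus)
              then show ?thesis by (intro mult_left_mono) auto
            qed (simp add: k_def)
          qed
        qed
      qed
    qed
    also have "\<dots> = (\<integral>\<^sup>+x. (\<integral>\<^sup>+y. k x y * (ennreal (f x) + ennreal \<omega>) \<partial>\<rho>) \<partial>\<mu>)"
      by (rule Fubini') measurable
    also have "\<dots> = (\<integral>\<^sup>+x. c' * (ennreal (f x) + ennreal \<omega>) \<partial>\<mu>)"
      using sphereAE by (intro nn_integral_cong_AE) (auto simp: ky nn_integral_multc)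
    also have "\<dots> = c' * (\<integral>\<^sup>+x. ennreal (f x) + ennreal \<omega> \<partial>\<mu>)"
      by (rule nn_integral_cmult) measurable
    also have "(\<integral>\<^sup>+x. ennreal (f x) + ennreal \<omega> \<partial>\<mu>) = ?J + ennreal \<omega>"
      using \<mu>.emeasure_space_1 by (subst nn_integral_add) auto
    finally have "c * ?I \<le> c * (?m * (?J + ennreal \<omega>))"
      by (simp add: cc' mult.assoc)
    then show ?thesis
      using \<open>c \<noteq> 0\<close> cfin by (simp add: ennreal_mult_le_mult_iff)
  qed
  have mfin: "?m < \<infinity>"
    using \<rho>.emeasure_finite[of UNIV] by (simp add: less_top[symmetric])
  show ?thesis
  proof (rule ennreal_le_epsilon)
    fix \<epsilon> :: real assume \<epsilon>: "0 < \<epsilon>"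
    define M where "M = enn2real ?m"
    have M: "?m = ennreal M" "0 \<le> M"
      using mfin by (auto simp: M_def)
    define \<omega> where "\<omega> = \<epsilon> / (M + 1)"
    have \<omega>: "\<omega> > 0" "M * \<omega> \<le> \<epsilon>"
      using M(2) \<epsilon> by (auto simp: \<omega>_def field_simps)
    have "?I \<le> ?m * ?J + ?m * ennreal \<omega>"
      using approx[OF \<omega>(1)] by (simp add: distrib_left)
    also have "?m * ennreal \<omega> = ennreal (M * \<omega>)"
      using M \<omega>(1) by (simp add: ennreal_mult)
    also have "\<dots> \<le> ennreal \<epsilon>"
      using \<omega>(2) by (rule ennreal_leI)
    finally show "?I \<le> ?m * ?J + ennreal \<epsilon>"
      by (simp add: add_left_mono)
  qed
qed

text \<open>
  Polar integration. The weight \<open>norm y\<close> is put into the measure \<open>\<rho>\<close> because a homogeneous \<open>f\<close> satisfies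
  \<open>f y = norm y * f (sgn y)\<close>.
\<close>

lemma ball_integral_le_sphere_integral:
  fixes \<mu> :: "(real ^ 'n) measure" and f :: "real ^ 'n \<Rightarrow> real"
  assumes \<mu>: "sphere_haar_measure \<mu>"
    and f: "continuous_on UNIV f" "\<And>x. 0 \<le> f x" "\<And>c x. 0 \<le> c \<Longrightarrow> f (c *\<^sub>R x) = c * f x"
    and R: "0 \<le> R"
  shows "(\<integral>\<^sup>+y. ennreal (f y) * indicator (ball 0 R) y \<partial>lborel)
    \<le> ennreal R * emeasure lborel (ball (0 :: real ^ 'n) R) * (\<integral>\<^sup>+x. ennreal (f x) \<partial>\<mu>)"
proof -
  define w :: "real ^ 'n \<Rightarrow> ennreal" where "w y = ennreal (norm y) * indicator (ball 0 R) y" for y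
  have [measurable]: "w \<in> borel_measurable borel"
    unfolding w_def by (intro borel_measurable_times_ennreal borel_measurable_indicator) auto
  have [measurable]: "f \<in> borel_measurable borel"
    using f(1) by (rule borel_measurable_continuous_onI)
  define \<rho> where "\<rho> = density lborel w"
  have s\<rho>[simp, measurable_cong]: "sets \<rho> = sets borel"
    by (simp add: \<rho>_def)
  have sp: "space \<rho> = UNIV"
    by (simp add: \<rho>_def)
  have mass: "emeasure \<rho> UNIV \<le> ennreal R * emeasure lborel (ball (0 :: real ^ 'n) R)"
  proof -
    have "emeasure \<rho> UNIV = (\<integral>\<^sup>+y. w y \<partial>lborel)"
      by (simp add: \<rho>_def emeasure_density)
    also have "\<dots> \<le> (\<integral>\<^sup>+y. ennreal R * indicator (ball (0 :: real ^ 'n) R) y \<partial>lborel)"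
      by (intro nn_integral_mono) (auto simp: w_def indicator_def intro: ennreal_leI)
    finally show ?thesis
      by (simp add: nn_integral_cmult_indicator)
  qed
  also have "\<dots> < \<infinity>"
    using emeasure_lborel_ball_finite[of "0 :: real ^ 'n" R] by (simp add: ennreal_mult_less_top)
  finally have fin: "finite_measure \<rho>"
    by (intro finite_measureI) (simp add: sp)
  have AE0: "AE y in \<rho>. y \<noteq> 0"
    unfolding \<rho>_def by (subst AE_density) (auto simp: w_def)
  have inv: "distr \<rho> borel g = \<rho>" if g: "orthogonal_transformation g" for g
  proof (rule measure_eqI)
    have [measurable]: "g \<in> borel_measurable borel"
      by (rule borel_measurable_orthogonal[OF g])
    fix A assume "A \<in> sets (distr \<rho> borel g)"
    then have [measurable]: "A \<in> sets borel" by simp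
    have gA: "g -` A \<in> sets borel"
      using measurable_sets_borel[of g borel A] by simp
    have wg: "w (g y) = w y" for y
      using g by (auto simp: w_def orthogonal_transformation_norm indicator_def)
    have "emeasure (distr \<rho> borel g) A = (\<integral>\<^sup>+y. w y * indicator (g -` A) y \<partial>lborel)"
      using gA by (simp add: emeasure_distr sp) (simp add: \<rho>_def emeasure_density)
    also have "\<dots> = (\<integral>\<^sup>+y. w (g y) * indicator A (g y) \<partial>lborel)"
      by (simp add: wg indicator_def)
    also have "\<dots> = (\<integral>\<^sup>+y. w y * indicator A y \<partial>distr lborel borel g)"
      by (subst nn_integral_distr) auto
    also have "\<dots> = emeasure \<rho> A"
      by (simp add: distr_lborel_orthogonal_transformation[OF g] \<rho>_def emeasure_density)
    finally show "emeasure (distr \<rho> borel g) A = emeasure \<rho> A" .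
  qed simp
  have "(\<integral>\<^sup>+y. ennreal (f y) * indicator (ball 0 R) y \<partial>lborel) = (\<integral>\<^sup>+y. ennreal (f (sgn y)) \<partial>\<rho>)"
  proof -
    have "ennreal (f y) * indicator (ball 0 R) y = w y * ennreal (f (sgn y))" for y
    proof -
      have "f y = norm y * f (sgn y)"
        using f(3)[of "norm y" "sgn y"] f(3)[of 0 y] by (cases "y = 0") (auto simp: sgn_div_norm)
      then show ?thesis
        using f(2) by (simp add: w_def ennreal_mult ac_simps)
    qed
    then show ?thesis
      unfolding \<rho>_def by (subst nn_integral_density) auto
  qed
  also have "\<dots> \<le> emeasure \<rho> UNIV * (\<integral>\<^sup>+x. ennreal (f x) \<partial>\<mu>)"
    by (rule sphere_haar_integral_comparison[OF \<mu> fin s\<rho> AE0 inv f(1,2)])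
  also have "\<dots> \<le> ennreal R * emeasure lborel (ball (0 :: real ^ 'n) R) * (\<integral>\<^sup>+x. ennreal (f x) \<partial>\<mu>)"
    using mass by (rule mult_right_mono) simp
  finally show ?thesis .
qed

lemma nn_integral_affine_ball_le:
  fixes a :: "'a::euclidean_space" and F :: "'a \<Rightarrow> ennreal"
  assumes [measurable]: "F \<in> borel_measurable borel"
    and c: "1 \<le> \<bar>c\<bar>" and R: "norm a + \<bar>c\<bar> * r \<le> R"
  shows "(\<integral>\<^sup>+z. F (a + c *\<^sub>R z) * indicator (ball 0 r) z \<partial>lborel)
    \<le> (\<integral>\<^sup>+y. F y * indicator (ball 0 R) y \<partial>lborel)"
proof -
  have [measurable]: "ball 0 R \<in> sets (borel :: 'a measure)"
    by simp
  have "(\<integral>\<^sup>+z. F (a + c *\<^sub>R z) * indicator (ball 0 r) z \<partial>lborel)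
      \<le> (\<integral>\<^sup>+z. ennreal (\<bar>c\<bar> ^ DIM('a)) * (F (a + c *\<^sub>R z) * indicator (ball 0 R) (a + c *\<^sub>R z)) \<partial>lborel)"
  proof (rule nn_integral_mono)
    fix z :: 'a
    have "1 \<le> ennreal (\<bar>c\<bar> ^ DIM('a))"
      using c by (metis ennreal_1 ennreal_leI one_le_power)
    then have 1: "x \<le> ennreal (\<bar>c\<bar> ^ DIM('a)) * x" for x
      using mult_right_mono[of 1 _ x] by simp
    have "norm (a + c *\<^sub>R z) < R" if "norm z < r"
    proof -
      have "norm (a + c *\<^sub>R z) \<le> norm a + \<bar>c\<bar> * norm z"
        using norm_triangle_ineq[of a "c *\<^sub>R z"] by simp
      also have "\<dots> < norm a + \<bar>c\<bar> * r"
        using mult_strict_left_mono[OF that, of "\<bar>c\<bar>"] c by linarith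
      finally show ?thesis using R by simp
    qed
    then show "F (a + c *\<^sub>R z) * indicator (ball 0 r) z
      \<le> ennreal (\<bar>c\<bar> ^ DIM('a)) * (F (a + c *\<^sub>R z) * indicator (ball 0 R) (a + c *\<^sub>R z))"
      using 1[of "F (a + c *\<^sub>R z)"] by (auto simp: indicator_def)
  qed
  also have "\<dots> = (\<integral>\<^sup>+y. F y * indicator (ball 0 R) y
      \<partial>density (distr lborel borel (\<lambda>z. a + c *\<^sub>R z)) (\<lambda>_. ennreal (\<bar>c\<bar> ^ DIM('a))))"
    by (simp add: nn_integral_density nn_integral_distr)
  also have "\<dots> = (\<integral>\<^sup>+y. F y * indicator (ball 0 R) y \<partial>lborel)"
    using lborel_affine[of c a] c by simp
  finally show ?thesis .
qed

section \<open>The regular simplex and the mean distance\<close>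

lemma regular_simplex_vertices:
  fixes T :: "real ^ 'n \<Rightarrow> real ^ 'n option"
  assumes T: "hyperplane_identification T"
  obtains v :: "'n option \<Rightarrow> real ^ 'n"
  where "regular_simplex T = convex hull (range v)"
    "\<And>i j. v i \<bullet> v j = (if i = j then 1 else 0) - 1 / real CARD('n option)"
proof -
  let ?N = "real CARD('n option)"
  define p :: "real ^ 'n option \<Rightarrow> real ^ 'n option"
    where "p x = x - ((1 \<bullet> x) / ?N) *\<^sub>R 1" for x
  have lin: "linear T" and nT: "\<And>x. norm (T x) = norm x" and ran: "range T = sum_zero_hyperplane"
    using T unfolding hyperplane_identification_def by auto
  have linp: "linear p"
    by (rule linearI) (auto simp: p_def inner_add_right algebra_simps add_divide_distrib)
  have one: "(1 :: real ^ 'n option) \<bullet> 1 = ?N"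
    by (rule one_inner_one_vec)
  have "p x \<in> range T" for x
    unfolding ran sum_zero_hyperplane_def
    by (simp add: p_def inner_diff_right one)
  then have "\<forall>i. \<exists>w. T w = p (axis i 1)"
    by (auto simp: image_iff eq_commute)
  then obtain v where v: "\<And>i. T (v i) = p (axis i 1)"
    by metis
  have inj: "inj T"
    using lin nT by (metis linear_injective_0 norm_eq_zero)
  have inner: "T x \<bullet> T y = x \<bullet> y" for x y
  proof -
    show ?thesis
      using nT[of "x + y"] nT[of x] nT[of y] by (simp add: dot_norm linear_add[OF lin])
  qed
  have "projected_simplex = p ` (convex hull (range (\<lambda>i::'n option. axis i 1)))"
    unfolding projected_simplex_def p_def closest_point_sum_zero_hyperplane ..
  also have "\<dots> = convex hull (p ` range (\<lambda>i. axis i 1))"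
    by (rule convex_hull_linear_image[OF linp])
  also have "p ` range (\<lambda>i. axis i 1) = T ` range v"
    by (simp add: image_image v)
  also have "convex hull (T ` range v) = T ` (convex hull (range v))"
    by (rule convex_hull_linear_image[OF lin, symmetric])
  finally have "regular_simplex T = convex hull (range v)"
    unfolding regular_simplex_def using inj_vimage_image_eq[OF inj] by metis
  moreover have "v i \<bullet> v j = (if i = j then 1 else 0) - 1 / ?N" for i j
  proof -
    have ax: "(1 :: real ^ 'n option) \<bullet> axis k 1 = 1" "axis k 1 \<bullet> (1 :: real ^ 'n option) = 1" for k
      by (simp_all add: inner_axis inner_axis')
    have "v i \<bullet> v j = p (axis i 1) \<bullet> p (axis j 1)"
      using inner[of "v i" "v j"] by (simp add: v)
    also have "\<dots> = axis i (1::real) \<bullet> axis j 1 - 1 / ?N"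
      by (simp add: p_def inner_diff_left inner_diff_right ax one)
    finally show ?thesis
      by (simp add: inner_axis_axis)
  qed
  ultimately show ?thesis by (rule that)
qed

text \<open>
  At \<open>z = 0\<close> the simplex has \<open>S(\<Delta>) = 1\<close> and total defect zero, so it violates the gap inequality with
  constant \<open>\<delta>\<close> by exactly \<open>\<delta>\<close>. Its support function has Lipschitz constant \<open>1\<close>, and each direction moves by
  at most \<open>N * norm z\<close>; the bound on \<open>norm z\<close> keeps the total loss below \<open>\<delta> / 2\<close>. As \<open>P\<close> obeys the inequality
  in the same directions, the two support functions have to differ there.
\<close>

lemma simplex_violates_gap:
  fixes v :: "'i::finite \<Rightarrow> 'a::euclidean_space" and c :: "'i \<Rightarrow> real"
  defines "N \<equiv> CARD('i)"
  defines "\<delta> \<equiv> 1 / real N ^ N"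
  defines "\<Delta> \<equiv> convex hull (range v)"
  assumes v: "\<And>i j. v i \<bullet> v j = (if i = j then 1 else 0) - 1 / real N"
    and c: "(\<Sum>i\<in>UNIV. c i) = 0" "\<And>i. \<bar>c i\<bar> \<le> N"
    and z: "norm z \<le> \<delta> / (4 * real N ^ 3)"
    and P: "P \<in> depth_class d" "2 ^ d < N"
  shows "\<delta> / 2 \<le> (\<Sum>i\<in>UNIV. \<bar>support_fun P (v i + (- c i) *\<^sub>R z) - support_fun \<Delta> (v i + (- c i) *\<^sub>R z)\<bar>)
    + N * (\<Sum>i\<in>UNIV. \<bar>support_fun P (- v i + c i *\<^sub>R z) - support_fun \<Delta> (- v i + c i *\<^sub>R z)\<bar>)"
proof -
  define u where "u i = - v i + c i *\<^sub>R z" for i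
  have mu: "v i + (- c i) *\<^sub>R z = - u i" for i
    by (simp add: u_def)
  define f where "f x = \<bar>support_fun P x - support_fun \<Delta> x\<bar>" for x
  have N2: "2 \<le> N"
    using P(2) one_le_power[of "2::nat" d] by linarith
  have N1: "1 \<le> real N" using N2 by simp
  have \<delta>: "0 < \<delta>" "\<delta> \<le> 1"
    using N1 by (auto simp: \<delta>_def)
  have "(\<Sum>i\<in>UNIV. v i) \<bullet> (\<Sum>i\<in>UNIV. v i) = (\<Sum>i\<in>UNIV. \<Sum>j\<in>UNIV. v i \<bullet> v j)"
    by (simp add: inner_sum_left inner_sum_right) (rule sum.swap)
  also have "\<dots> = 0"
    using N2 by (simp add: v sum_subtractf N_def)
  finally have v0: "(\<Sum>i\<in>UNIV. v i) = 0" by simp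
  have u0: "(\<Sum>i\<in>UNIV. u i) = 0"
    by (simp add: u_def sum_subtractf v0 c(1) flip: scaleR_left.sum)
  have cP: "compact P" "P \<noteq> {}"
    using depth_class_compact[OF P(1)] by auto
  have c\<Delta>: "compact \<Delta>" "\<Delta> \<noteq> {}"
    unfolding \<Delta>_def by (simp_all add: compact_convex_hull finite_imp_compact)
  have v\<Delta>: "v i \<in> \<Delta>" for i
    unfolding \<Delta>_def by (intro hull_inc) auto
  have norm1: "norm y \<le> 1" if "y \<in> \<Delta>" for y
  proof -
    have "norm (v i) \<le> 1" for i
      using v[of i i] by (simp add: norm_le_square)
    then have "\<Delta> \<subseteq> cball 0 1"
      unfolding \<Delta>_def by (intro hull_minimal) auto
    with that show ?thesis by auto
  qed
  define b where "b = \<delta> / (4 * real N ^ 2)"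
  have bz: "norm (c i *\<^sub>R z) \<le> b" for i
  proof -
    have "norm (c i *\<^sub>R z) \<le> real N * (\<delta> / (4 * real N ^ 3))"
      unfolding norm_scaleR using c(2)[of i] z by (intro mult_mono) auto
    also have "\<dots> = b"
      using N1 by (simp add: b_def power2_eq_square power3_eq_cube)
    finally show ?thesis .
  qed
  have \<Delta>hi: "support_fun \<Delta> (u i) \<le> 1 / N + b" for i
  proof -
    have "support_fun \<Delta> (- v i) \<le> 1 / N"
    proof (rule support_fun_le[OF c\<Delta>])
      fix y assume "y \<in> \<Delta>"
      then show "- v i \<bullet> y \<le> 1 / N"
        unfolding \<Delta>_def by (rule hull_inner_le) (auto simp: v)
    qed
    then show ?thesis
      using support_fun_Lipschitz[OF c\<Delta> norm1, of "u i" "- v i"] bz[of i] by (simp add: u_def)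
  qed
  have \<Delta>lo: "1 - 1 / N - b \<le> support_fun \<Delta> (- u i)" for i
    using support_fun_Lipschitz[OF c\<Delta> norm1, of "v i" "- u i"] bz[of i]
      support_fun_upper[OF c\<Delta>(1) v\<Delta>[of i], of "v i"] v[of i i]
    by (simp add: u_def)
  have dN: "d \<le> N"
    using P(2) less_exp[of d] by linarith
  have S0: "0 \<le> (\<Sum>i\<in>UNIV. support_fun P (u i))"
    by (rule support_fun_sum_nonneg[OF cP u0])
  have "\<delta> \<le> 1 / real N ^ d"
    unfolding \<delta>_def using N1 dN by (intro divide_left_mono power_increasing) auto
  then have "(real N - 1 - 1 / real N ^ d) * (\<Sum>i\<in>UNIV. support_fun P (u i))
      \<le> (real N - 1 - \<delta>) * (\<Sum>i\<in>UNIV. support_fun P (u i))"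
    using S0 by (intro mult_right_mono) auto
  moreover have "(\<Sum>i\<in>UNIV. support_fun P (- u i))
      \<le> (real N - 1 - 1 / real N ^ d) * (\<Sum>i\<in>UNIV. support_fun P (u i))"
    using depth_class_gap[of "UNIV :: 'i set" N d u P] u0 P by (simp add: N_def)
  ultimately have "(\<Sum>i\<in>UNIV. support_fun P (- u i)) \<le> (real N - 1 - \<delta>) * (\<Sum>i\<in>UNIV. support_fun P (u i))"
    by linarith
  moreover have "(\<Sum>i\<in>UNIV. 1 - 1 / N - b - f (- u i)) \<le> (\<Sum>i\<in>UNIV. support_fun P (- u i))"
  proof (rule sum_mono)
    fix i show "1 - 1 / N - b - f (- u i) \<le> support_fun P (- u i)"
      using \<Delta>lo[of i] by (simp add: f_def)
  qed
  moreover have "(real N - 1 - \<delta>) * (\<Sum>i\<in>UNIV. support_fun P (u i))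
      \<le> (real N - 1 - \<delta>) * (\<Sum>i\<in>UNIV. 1 / N + b + f (u i))"
  proof (intro mult_left_mono sum_mono)
    fix i show "support_fun P (u i) \<le> 1 / N + b + f (u i)"
      using \<Delta>hi[of i] by (simp add: f_def)
  qed (use N2 \<delta> in auto)
  moreover have "real N * (1 / N + b) = 1 + N * b"
    using N1 by (simp add: field_simps)
  ultimately have "real N - 1 - N * b - (\<Sum>i\<in>UNIV. f (- u i))
      \<le> (real N - 1 - \<delta>) * (1 + N * b + (\<Sum>i\<in>UNIV. f (u i)))"
    using N1 by (simp add: sum_subtractf sum.distrib N_def[symmetric] right_diff_distrib)
  moreover have "(real N - 1 - \<delta>) * (N * b + (\<Sum>i\<in>UNIV. f (u i))) \<le> N * (N * b + (\<Sum>i\<in>UNIV. f (u i)))"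
    using \<delta> N1 by (intro mult_right_mono add_nonneg_nonneg sum_nonneg) (auto simp: f_def b_def)
  ultimately have "\<delta> - N * b - N * (N * b) \<le> (\<Sum>i\<in>UNIV. f (- u i)) + N * (\<Sum>i\<in>UNIV. f (u i))"
    by (simp add: algebra_simps)
  moreover have "N * (N * b) = \<delta> / 4"
    using N1 by (simp add: b_def power2_eq_square)
  moreover have "N * b \<le> N * (N * b)"
    using N1 \<delta> by (simp add: b_def mult_le_cancel_right1 field_simps)
  ultimately show ?thesis
    unfolding mu u_def[symmetric] f_def[symmetric] by simp
qed

theorem mainTheorem9:
  shows "\<exists>\<epsilon>\<^sub>0 > (0::real). \<forall>(T :: real ^ 'n \<Rightarrow> real ^ 'n option) (\<mu> :: (real ^ 'n) measure) (P :: (real ^ 'n) set).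
    hyperplane_identification T \<longrightarrow> sphere_haar_measure \<mu> \<longrightarrow>
    polytope P \<longrightarrow> P \<noteq> {} \<longrightarrow>
    int (depth_complexity P) < \<lceil>log 2 (real CARD('n) + 1)\<rceil> \<longrightarrow>
    (LINT x|\<mu>. \<bar>support_fun P x - support_fun (regular_simplex T) x\<bar>) \<ge> \<epsilon>\<^sub>0"
proof -
  define N where "N = CARD('n option)"
  have Nn: "N = Suc CARD('n)" by (simp add: N_def)
  define \<delta> where "\<delta> = 1 / real N ^ N"
  \<comment> \<open>The radius is chosen so that \<open>simplex_violates_gap\<close> applies to all \<open>z\<close> in the ball. All perturbed directions then lie in a ball of radius 2.\<close>
  define r where "r = \<delta> / (4 * real N ^ 3)"
  define V where "V t = measure lborel (ball (0 :: real ^ 'n) t)" for t :: real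
  define C where "C = (N + real N * N) * (2 * V 2)"
  define \<epsilon>\<^sub>0 where "\<epsilon>\<^sub>0 = \<delta> / 2 * V r / C"
  have N1: "1 \<le> real N" by (simp add: Nn)
  have \<delta>: "0 < \<delta>" "\<delta> \<le> 1" using N1 by (auto simp: \<delta>_def)
  have r0: "0 < r" using \<delta> N1 by (simp add: r_def)
  have V: "0 < V t" "emeasure lborel (ball (0 :: real ^ 'n) t) = ennreal (V t)" if "0 < t" for t
    using content_ball_pos[OF that, of "0 :: real ^ 'n"] emeasure_lborel_ball_finite[of "0 :: real ^ 'n" t]
    by (auto simp: V_def emeasure_eq_ennreal_measure)
  have C0: "0 < C" using N1 V(1)[of 2] by (simp add: C_def add_pos_pos)
  have \<epsilon>0: "0 < \<epsilon>\<^sub>0" using \<delta> V(1)[OF r0] C0 by (simp add: \<epsilon>\<^sub>0_def)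
  have "(LINT x|\<mu>. \<bar>support_fun P x - support_fun (regular_simplex T) x\<bar>) \<ge> \<epsilon>\<^sub>0"
    if T: "hyperplane_identification T" and \<mu>: "sphere_haar_measure \<mu>"
      and P: "polytope P" "P \<noteq> {}"
      and d: "int (depth_complexity P) < \<lceil>log 2 (real CARD('n) + 1)\<rceil>"
    for T :: "real ^ 'n \<Rightarrow> real ^ 'n option" and \<mu> :: "(real ^ 'n) measure" and P :: "(real ^ 'n) set"
  proof -
    obtain v :: "'n option \<Rightarrow> real ^ 'n" where \<Delta>: "regular_simplex T = convex hull (range v)"
      and v: "\<And>i j. v i \<bullet> v j = (if i = j then 1 else 0) - 1 / real CARD('n option)"
      using regular_simplex_vertices[OF T] by blast
    define f where "f x = \<bar>support_fun P x - support_fun (regular_simplex T) x\<bar>" for x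
    have c\<Delta>: "compact (regular_simplex T)" "regular_simplex T \<noteq> {}"
      unfolding \<Delta> by (simp_all add: compact_convex_hull finite_imp_compact)
    have cP: "compact P" using P(1) by (rule polytope_imp_compact)
    have fc: "continuous_on UNIV f"
      unfolding f_def using c\<Delta> cP P(2)
      by (intro continuous_intros continuous_support_fun)
    have f0: "0 \<le> f x" for x by (simp add: f_def)
    have fs: "f (t *\<^sub>R x) = t * f x" if "0 \<le> t" for t x
      using that c\<Delta> cP P(2)
      by (simp add: f_def support_fun_scaleR abs_mult flip: right_diff_distrib)
    have [measurable]: "f \<in> borel_measurable borel"
      using fc by (rule borel_measurable_continuous_onI)
    have Pd: "P \<in> depth_class (depth_complexity P)"
      unfolding depth_complexity_def using polytope_in_depth_class[OF P] by (rule LeastI_ex)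
    have "real (depth_complexity P) < log 2 (real N)"
      using d by (simp add: less_ceiling_iff Nn add.commute)
    then have "2 powr real (depth_complexity P) < real N"
      using N1 by (simp add: less_log_iff)
    then have dN: "2 ^ depth_complexity P < N"
      by (simp add: powr_realpow flip: of_nat_less_iff)
    \<comment> \<open>Sum zero with all \<open>\<bar>c i\<bar> \<ge> 1\<close>, so that \<open>z \<mapsto> c i *\<^sub>R z\<close> does not contract volume.\<close>
    define c :: "'n option \<Rightarrow> real" where "c i = (if i = None then - real CARD('n) else 1)" for i
    have c1: "1 \<le> \<bar>c i\<bar>" and cN: "\<bar>c i\<bar> \<le> real N" for i
      by (auto simp: c_def Nn Suc_le_eq)
    have csum: "(\<Sum>i\<in>UNIV. c i) = 0"
      by (simp add: c_def UNIV_option_conv sum.reindex)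
    let ?B = "\<lambda>t. indicator (ball (0 :: real ^ 'n) t) :: real ^ 'n \<Rightarrow> ennreal"
    have [measurable]: "ball 0 t \<in> sets (borel :: (real ^ 'n) measure)" for t
      by simp
    let ?A = "\<integral>\<^sup>+y. ennreal (f y) * ?B 2 y \<partial>lborel"
    have nv: "norm (v i) \<le> 1" for i
      using v[of i i] by (simp add: norm_le_square)
    have "r \<le> 1 / N"
    proof -
      have "r \<le> 1 / (4 * real N ^ 3)"
        unfolding r_def using \<delta> N1 by (intro divide_right_mono) auto
      also have "\<dots> \<le> 1 / N"
      proof (rule divide_left_mono)
        have "real N ^ 1 \<le> real N ^ 3"
          using N1 by (intro power_increasing) auto
        then show "real N \<le> 4 * real N ^ 3"
          using N1 unfolding power_one_right by linarith
      qed (use N1 in auto)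
      finally show ?thesis .
    qed
    then have "N * r \<le> 1"
      using N1 by (simp add: field_simps)
    then have cr: "\<bar>c i\<bar> * r \<le> 1" for i
      using mult_right_mono[OF cN[of i], of r] r0 by linarith
    have up: "(\<integral>\<^sup>+z. ennreal (f (v i + (- c i) *\<^sub>R z)) * ?B r z \<partial>lborel) \<le> ?A"
      "(\<integral>\<^sup>+z. ennreal (f (- v i + c i *\<^sub>R z)) * ?B r z \<partial>lborel) \<le> ?A" for i
      using nn_integral_affine_ball_le[of "\<lambda>y. ennreal (f y)" "- c i" "v i" r 2]
        nn_integral_affine_ball_le[of "\<lambda>y. ennreal (f y)" "c i" "- v i" r 2] c1[of i] cr[of i] nv[of i]
      by simp_all
    have lin: "(\<integral>\<^sup>+z. (\<Sum>i\<in>UNIV. G i z) + ennreal N * (\<Sum>i\<in>UNIV. H i z) \<partial>lborel)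
        = (\<Sum>i\<in>UNIV. \<integral>\<^sup>+z. G i z \<partial>lborel) + ennreal N * (\<Sum>i\<in>UNIV. \<integral>\<^sup>+z. H i z \<partial>lborel)"
      if [measurable]: "\<And>i. G i \<in> borel_measurable borel" "\<And>i. H i \<in> borel_measurable borel"
      for G H :: "'n option \<Rightarrow> real ^ 'n \<Rightarrow> ennreal"
      by (simp add: nn_integral_add nn_integral_sum nn_integral_cmult)
    have "ennreal (\<delta> / 2) * ennreal (V r) = (\<integral>\<^sup>+z. ennreal (\<delta> / 2) * ?B r z \<partial>lborel)"
      using V(2)[OF r0] by (simp add: nn_integral_cmult_indicator)
    also have "\<dots> \<le> (\<integral>\<^sup>+z. (\<Sum>i\<in>UNIV. ennreal (f (v i + (- c i) *\<^sub>R z)) * ?B r z)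
        + ennreal N * (\<Sum>i\<in>UNIV. ennreal (f (- v i + c i *\<^sub>R z)) * ?B r z) \<partial>lborel)"
    proof (rule nn_integral_mono)
      fix z :: "real ^ 'n"
      show "ennreal (\<delta> / 2) * ?B r z \<le> (\<Sum>i\<in>UNIV. ennreal (f (v i + (- c i) *\<^sub>R z)) * ?B r z)
        + ennreal N * (\<Sum>i\<in>UNIV. ennreal (f (- v i + c i *\<^sub>R z)) * ?B r z)"
      proof (cases "z \<in> ball 0 r")
        case True
        then have "norm z \<le> r" by simp
        then have "\<delta> / 2 \<le> (\<Sum>i\<in>UNIV. f (v i + (- c i) *\<^sub>R z)) + N * (\<Sum>i\<in>UNIV. f (- v i + c i *\<^sub>R z))"
          unfolding f_def \<Delta> \<delta>_def N_def r_def
          using simplex_violates_gap[OF v csum _ _ Pd] cN dN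
          unfolding N_def by blast
        then have "ennreal (\<delta> / 2) \<le> ennreal ((\<Sum>i\<in>UNIV. f (v i + (- c i) *\<^sub>R z)) + N * (\<Sum>i\<in>UNIV. f (- v i + c i *\<^sub>R z)))"
          by (rule ennreal_leI)
        also have "\<dots> = (\<Sum>i\<in>UNIV. ennreal (f (v i + (- c i) *\<^sub>R z))) + ennreal N * (\<Sum>i\<in>UNIV. ennreal (f (- v i + c i *\<^sub>R z)))"
          using f0 by (simp add: ennreal_plus ennreal_mult sum_nonneg sum_ennreal)
        finally show ?thesis using True by simp
      qed simp
    qed
    also have "\<dots> = (\<Sum>i\<in>UNIV. \<integral>\<^sup>+z. ennreal (f (v i + (- c i) *\<^sub>R z)) * ?B r z \<partial>lborel)
        + ennreal N * (\<Sum>i\<in>UNIV. \<integral>\<^sup>+z. ennreal (f (- v i + c i *\<^sub>R z)) * ?B r z \<partial>lborel)"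
      by (rule lin) measurable
    also have "\<dots> \<le> (\<Sum>i\<in>(UNIV :: 'n option set). ?A) + ennreal N * (\<Sum>i\<in>(UNIV :: 'n option set). ?A)"
      by (intro add_mono mult_left_mono sum_mono up) auto
    also have "\<dots> = ennreal (N + real N * N) * ?A"
      unfolding sum_constant N_def[symmetric] ennreal_of_nat_eq_real_of_nat
      by (simp add: ennreal_plus ennreal_mult distrib_right mult.assoc)
    also have "\<dots> \<le> ennreal (N + real N * N) * (ennreal 2 * ennreal (V 2) * (\<integral>\<^sup>+x. ennreal (f x) \<partial>\<mu>))"
      using ball_integral_le_sphere_integral[OF \<mu> fc f0 fs, of 2] V(2)[of 2]
      by (intro mult_left_mono) auto
    also have "\<dots> = ennreal C * (\<integral>\<^sup>+x. ennreal (f x) \<partial>\<mu>)"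
      using V(1)[of 2] by (simp add: C_def ennreal_mult mult.assoc)
    also have "(\<integral>\<^sup>+x. ennreal (f x) \<partial>\<mu>) = ennreal (LINT x|\<mu>. f x)"
    proof (rule nn_integral_eq_integral)
      interpret \<mu>: prob_space \<mu> using \<mu> by (simp add: sphere_haar_measure_def)
      have s\<mu>[measurable_cong]: "sets \<mu> = sets borel" and \<mu>s: "emeasure \<mu> (sphere 0 1) = 1"
        using \<mu> by (auto simp: sphere_haar_measure_def)
      have "compact (f ` sphere 0 1)"
        using fc by (intro compact_continuous_image) (auto intro: continuous_on_subset)
      then obtain B where B: "\<And>x. x \<in> sphere 0 1 \<Longrightarrow> norm (f x) \<le> B"
        using compact_imp_bounded by (metis bounded_iff imageI)
      have "AE x in \<mu>. x \<in> sphere 0 1"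
        using \<mu>.AE_prob_1[of "sphere 0 1"] \<mu>s by (simp add: \<mu>.emeasure_eq_measure)
      then have "AE x in \<mu>. norm (f x) \<le> B"
        by eventually_elim (rule B)
      then show "integrable \<mu> f"
        by (intro \<mu>.integrable_const_bound) auto
    qed (use f0 in auto)
    finally have "ennreal (\<delta> / 2 * V r) \<le> ennreal (C * (LINT x|\<mu>. f x))"
      using \<delta> V(1)[OF r0] C0 f0 by (simp flip: ennreal_mult)
    then have "\<delta> / 2 * V r \<le> C * (LINT x|\<mu>. f x)"
      using C0 f0 by (subst (asm) ennreal_le_iff) auto
    then show ?thesis
      using C0 by (simp add: \<epsilon>\<^sub>0_def f_def field_simps)
  qed
  with \<epsilon>0 show ?thesis by blast
qed

end
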